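(* Let $G$ be a group. Every separating family of finite-index normal subgroups of $G$ is semi-conjugacy-separating. The same is true for any family $\sigma$ of finite-index subgroups of $G$ satisfying that there exists a separating family $\tau$ of finite-index normal subgroups of $G$ such that for any $G_\beta\in\tau$ there is $G_\alpha\in\sigma$ such that $G_\alpha$ is a subgroup of $G_\beta$.
   Context: A family $\sigma$ of finite-index subgroups of $G$ is called separating if for any non-empty finite subset $F\subset G\setminus\{1\}$ there is $G_\alpha\in\sigma$ such that $g\notin G_\alpha$ for any $g\in F$. It is called semi-conjugacy-separating if for any non-empty finite subset $F\subset G$ there is $G_\alpha\in\sigma$ such that $G_\alpha\cap g^G G_\alpha=\varnothing$ for every $g\in F\setminus\{1\}$, where $g^G$ is the conjugacy class of $g$.
   Formalization: Families of finite-index subgroups are required to be non-empty; this matters only for the trivial group, where the empty family is vacuously separating but not semi-conjugacy-separating (take F = {1}). *)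

theory Defs
  imports "HOL-Algebra.Coset"
begin

text \<open>
  Families are sets of subgroups, and they are required to be non-empty. Over a non-trivial group
  every separating family is non-empty anyway. Over the trivial group the empty family is vacuously
  separating, but it is not semi-conjugacy-separating: for \<open>F = {\<one>}\<close> the latter still asks for a member.
\<close>

definition finite_index_family :: "('a, 'b) monoid_scheme \<Rightarrow> 'a set set \<Rightarrow> bool" where
  "finite_index_family G \<sigma> \<longleftrightarrow>
     \<sigma> \<noteq> {} \<and> (\<forall>H\<in>\<sigma>. subgroup H G \<and> finite (rcosets\<^bsub>G\<^esub> H))"

definition separating :: "('a, 'b) monoid_scheme \<Rightarrow> 'a set set \<Rightarrow> bool" where
  "separating G \<sigma> \<longleftrightarrow>
     (\<forall>F. finite F \<and> F \<noteq> {} \<and> F \<subseteq> carrier G - {\<one>\<^bsub>G\<^esub>} \<longrightarrow>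
          (\<exists>H\<in>\<sigma>. \<forall>g\<in>F. g \<notin> H))"

definition conjugacy_class :: "('a, 'b) monoid_scheme \<Rightarrow> 'a \<Rightarrow> 'a set" where
  "conjugacy_class G g = {x \<otimes>\<^bsub>G\<^esub> g \<otimes>\<^bsub>G\<^esub> inv\<^bsub>G\<^esub> x | x. x \<in> carrier G}"

definition semi_conjugacy_separating :: "('a, 'b) monoid_scheme \<Rightarrow> 'a set set \<Rightarrow> bool" where
  "semi_conjugacy_separating G \<sigma> \<longleftrightarrow>
     (\<forall>F. finite F \<and> F \<noteq> {} \<and> F \<subseteq> carrier G \<longrightarrow>
          (\<exists>H\<in>\<sigma>. \<forall>g\<in>F - {\<one>\<^bsub>G\<^esub>}. H \<inter> (conjugacy_class G g <#>\<^bsub>G\<^esub> H) = {}))"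

end

theory Submission
  imports Defs
begin

lemma (in normal) conj_class_set_mult_disjoint:
  assumes g: "g \<in> carrier G" "g \<notin> H"
  shows "H \<inter> (conjugacy_class G g <#> H) = {}"
proof -
  have False if "x \<in> carrier G" "n \<in> H" and mem: "x \<otimes> g \<otimes> inv x \<otimes> n \<in> H" for x n
  proof -
    have n: "n \<in> carrier G"
      using that(2) by (rule mem_carrier)
    have "x \<otimes> g \<otimes> inv x \<otimes> n \<otimes> inv n \<in> H"
      using mem that(2) by (blast intro: subgroup.m_closed[OF subgroup_axioms] subgroup.m_inv_closed[OF subgroup_axioms])
    then have "x \<otimes> g \<otimes> inv x \<in> H"
      using that(1) g n by (simp add: m_assoc)
    then have "inv x \<otimes> (x \<otimes> g \<otimes> inv x) \<otimes> x \<in> H"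
      using that(1) by (intro inv_op_closed1)
    moreover have "inv x \<otimes> (x \<otimes> g \<otimes> inv x) \<otimes> x = g"
      using that(1) g by (simp add: m_assoc inv_solve_left')
    ultimately show False
      using g by simp
  qed
  then show ?thesis
    by (auto simp: conjugacy_class_def set_mult_def)
qed

lemma semi_conjugacy_separating_if_refines:
  fixes G (structure)
  assumes "\<tau> \<noteq> {}" and normal: "\<forall>N\<in>\<tau>. N \<lhd> G" and sep: "separating G \<tau>"
    and refines: "\<forall>N\<in>\<tau>. \<exists>H\<in>\<sigma>. H \<subseteq> N"
  shows "semi_conjugacy_separating G \<sigma>"
  unfolding semi_conjugacy_separating_def
proof (intro allI impI)
  fix F assume F: "finite F \<and> F \<noteq> {} \<and> F \<subseteq> carrier G"
  obtain N where N: "N \<in> \<tau>" "\<forall>g\<in>F - {\<one>}. g \<notin> N"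
  proof (cases "F - {\<one>} = {}")
    case True
    then show thesis
      using that \<open>\<tau> \<noteq> {}\<close> by blast
  next
    case False
    moreover have "finite (F - {\<one>})" "F - {\<one>} \<subseteq> carrier G - {\<one>}"
      using F by auto
    ultimately show thesis
      using sep that unfolding separating_def by meson
  qed
  obtain H where H: "H \<in> \<sigma>" "H \<subseteq> N"
    using refines N(1) by blast
  have "H \<inter> (conjugacy_class G g <#> H) = {}" if "g \<in> F - {\<one>}" for g
  proof -
    have "N \<inter> (conjugacy_class G g <#> N) = {}"
      using N normal F that by (intro normal.conj_class_set_mult_disjoint) auto
    then show ?thesis
      using H(2) by (auto simp: set_mult_def)
  qed
  then show "\<exists>H\<in>\<sigma>. \<forall>g\<in>F - {\<one>}. H \<inter> (conjugacy_class G g <#> H) = {}"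
    using H(1) by blast
qed

theorem corollary3p13:
  fixes G :: "('a, 'b) monoid_scheme"
  assumes "group G"
  shows "(\<forall>\<sigma>. finite_index_family G \<sigma> \<and> (\<forall>N\<in>\<sigma>. N \<lhd> G) \<and> separating G \<sigma>
              \<longrightarrow> semi_conjugacy_separating G \<sigma>)
       \<and> (\<forall>\<sigma>. finite_index_family G \<sigma> \<and>
              (\<exists>\<tau>. finite_index_family G \<tau> \<and> (\<forall>N\<in>\<tau>. N \<lhd> G) \<and> separating G \<tau> \<and>
                   (\<forall>N\<in>\<tau>. \<exists>H\<in>\<sigma>. H \<subseteq> N))
              \<longrightarrow> semi_conjugacy_separating G \<sigma>)"
  using semi_conjugacy_separating_if_refines[of _ G]
  unfolding finite_index_family_def by (meson order_refl)

end
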